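(* The closed 2-forms $dy_1\wedge dz_1+dH_1\wedge dt$ on $\mathcal{W}_1$, $dy_3\wedge dz_3+dH_3\wedge dt$ on $\mathcal{W}_3$ and $dy_{12}\wedge dz_{12}+dH_{12}\wedge dt$ on $\mathcal{W}_{12}$ (all relative to $\operatorname{Spec}\mathbb{C}[c]$) glue together and define a 2-form $\omega_c$ on $\mathcal{W}_1\cup\mathcal{W}_3\cup\mathcal{W}_{12}$ over $\operatorname{Spec}\mathbb{C}[c]$.
   Context: The ground field is $\mathbb{C}$. Let $\mathcal{W}_i=\operatorname{Spec}\mathbb{C}[y_i,z_i,t,c]$ for $i=1,3,12$. They are glued to a variety $\mathcal{W}_1\cup\mathcal{W}_3\cup\mathcal{W}_{12}$ over $\operatorname{Spec}\mathbb{C}[t,c]$ (so points are identified only if they have the same $t$ and the same $c$) by the rules: $\mathcal{W}_1,\mathcal{W}_3$: $y_1y_3=1$ and $z_1=y_3(c-y_3z_3)$; $\mathcal{W}_1,\mathcal{W}_{12}$: $y_1y_{12}=1$ and $z_1+2y_1^2+t=y_{12}(-(c+1)-y_{12}z_{12})$; $\mathcal{W}_3,\mathcal{W}_{12}$: $y_3=y_{12}\ne0$ and $z_3=z_{12}+\frac{2c+1}{y_{12}}+\frac{t}{y_{12}^2}+\frac{2}{y_{12}^4}$. (In the paper this variety is denoted $\mathfrak{X}\setminus\mathfrak{D}$; it is the family of spaces of initial conditions of the second Painlevé equation.) All differentials and wedge products are taken relative to $\mathbb{C}[c]$: $dc=0$ but $dt\neq0$. $H_1=y_1^2z_1+\frac12z_1^2+\frac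 t2z_1-cy_1$, $H_3(t,c,y_3,z_3)=H_1\bigl(t,c,\tfrac1{y_3},y_3(c-y_3z_3)\bigr)$ and $H_{12}(t,c,y_{12},z_{12})=H_3\bigl(t,c,y_{12},z_{12}+\frac{2c+1}{y_{12}}+\frac{t}{y_{12}^2}+\frac{2}{y_{12}^4}\bigr)-\frac1{y_{12}}$; these are polynomials in their variables. *)

theory Defs
  imports "HOL-Analysis.Analysis" "HOL-Computational_Algebra.Polynomial"
begin

section \<open>Affine four-space and its polynomial functions\<close>

text \<open>
  Varieties over the complex numbers are represented by their closed points. A point of
  \<open>Spec C[y, z, t, c]\<close> is the tuple \<open>(y, z, t, c)\<close>; since the field is infinite, elements of the
  coordinate ring are the same thing as polynomial functions.
\<close>

type_synonym affine4 = "complex \<times> complex \<times> complex \<times> complex"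

fun y_of :: "affine4 \<Rightarrow> complex" where "y_of (y, z, t, c) = y"
fun z_of :: "affine4 \<Rightarrow> complex" where "z_of (y, z, t, c) = z"
fun t_of :: "affine4 \<Rightarrow> complex" where "t_of (y, z, t, c) = t"
fun c_of :: "affine4 \<Rightarrow> complex" where "c_of (y, z, t, c) = c"

inductive_set poly_fun :: "(affine4 \<Rightarrow> complex) set" where
  const: "(\<lambda>_. a) \<in> poly_fun"
| y: "y_of \<in> poly_fun"
| z: "z_of \<in> poly_fun"
| t: "t_of \<in> poly_fun"
| c: "c_of \<in> poly_fun"
| add: "P \<in> poly_fun \<Longrightarrow> Q \<in> poly_fun \<Longrightarrow> (\<lambda>p. P p + Q p) \<in> poly_fun"
| mult: "P \<in> poly_fun \<Longrightarrow> Q \<in> poly_fun \<Longrightarrow> (\<lambda>p. P p * Q p) \<in> poly_fun"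

definition zariski_open4 :: "affine4 set \<Rightarrow> bool" where
  "zariski_open4 S \<longleftrightarrow> (\<exists>F\<subseteq>poly_fun. S = {p. \<exists>P\<in>F. P p \<noteq> 0})"


section \<open>The glued variety\<close>

datatype chart = W1 | W3 | W12

inductive gluing :: "chart \<times> affine4 \<Rightarrow> chart \<times> affine4 \<Rightarrow> bool" where
  W1_W3: "y1 * y3 = 1 \<Longrightarrow> z1 = y3 * (c - y3 * z3) \<Longrightarrow>
    gluing (W1, (y1, z1, t, c)) (W3, (y3, z3, t, c))"
| W1_W12: "y1 * y12 = 1 \<Longrightarrow> z1 + 2 * y1^2 + t = y12 * (- (c + 1) - y12 * z12) \<Longrightarrow>
    gluing (W1, (y1, z1, t, c)) (W12, (y12, z12, t, c))"
| W3_W12: "y3 = y12 \<Longrightarrow> y12 \<noteq> 0 \<Longrightarrow> z3 = z12 + (2 * c + 1) / y12 + t / y12^2 + 2 / y12^4 \<Longrightarrow>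
    gluing (W3, (y3, z3, t, c)) (W12, (y12, z12, t, c))"

type_synonym point = "(chart \<times> affine4) set"

definition glue_rel :: "((chart \<times> affine4) \<times> (chart \<times> affine4)) set" where
  "glue_rel = {(a, b). equivclp gluing a b}"

definition variety :: "point set" where
  "variety = UNIV // glue_rel"

definition chart_map :: "chart \<Rightarrow> affine4 \<Rightarrow> point" where
  "chart_map i p = glue_rel `` {(i, p)}"

definition chart_dom :: "chart \<Rightarrow> point set" where
  "chart_dom i = range (chart_map i)"

definition coord :: "chart \<Rightarrow> point \<Rightarrow> affine4" where
  "coord i x = (THE p. (i, p) \<in> x)"

definition y_coord :: "chart \<Rightarrow> point \<Rightarrow> complex" where
  "y_coord i x = y_of (coord i x)"

definition z_coord :: "chart \<Rightarrow> point \<Rightarrow> complex" where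
  "z_coord i x = z_of (coord i x)"

text \<open>The structure morphism to \<open>Spec C[t, c]\<close> does not depend on a chart.\<close>

definition t_fun :: "point \<Rightarrow> complex" where
  "t_fun x = (THE s. \<exists>i p. (i, p) \<in> x \<and> t_of p = s)"

definition c_fun :: "point \<Rightarrow> complex" where
  "c_fun x = (THE s. \<exists>i p. (i, p) \<in> x \<and> c_of p = s)"

text \<open>
  Points with \<open>y \<noteq> 0\<close> in \<open>W3\<close> or \<open>W12\<close> are identified with a unique point of \<open>W1\<close>. This normal form
  describes the generated equivalence relation; no two points of the same chart are identified,
  so \<open>coord\<close>, \<open>t_fun\<close> and \<open>c_fun\<close> have their intended values.
\<close>

fun normal_form :: "chart \<times> affine4 \<Rightarrow> chart \<times> affine4" where
  "normal_form (W1, p) = (W1, p)"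
| "normal_form (W3, (y, z, t, c)) =
     (if y = 0 then (W3, (y, z, t, c)) else (W1, (1 / y, y * (c - y * z), t, c)))"
| "normal_form (W12, (y, z, t, c)) =
     (if y = 0 then (W12, (y, z, t, c))
      else (W1, (1 / y, y * (- (c + 1) - y * z) - 2 * (1 / y)^2 - t, t, c)))"

lemma gluing_normal_form: "gluing a b \<Longrightarrow> normal_form a = normal_form b"
proof (induction rule: gluing.induct)
  case (W1_W3 y1 y3 z1 c z3 t)
  hence "y3 \<noteq> 0" by auto
  with W1_W3 show ?case by (simp add: eq_divide_eq)
next
  case (W1_W12 y1 y12 z1 t c z12)
  hence "y12 \<noteq> 0" "y1 = 1 / y12" by (auto simp: eq_divide_eq)
  with W1_W12 show ?case by (simp add: algebra_simps)
next
  case (W3_W12 y3 y12 z3 z12 c t)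
  have "y12 * (c - y12 * z3) = y12 * (- (c + 1) - y12 * z12) - 2 * (1 / y12)^2 - t"
    using W3_W12 by (simp add: field_simps power2_eq_square power4_eq_xxxx)
  with W3_W12 show ?case by simp
qed

lemma equivclp_normal_form: "equivclp gluing (normal_form a) a"
proof (cases a rule: normal_form.cases)
  case (1 p)
  then show ?thesis by simp
next
  case (2 y z t c)
  then show ?thesis by (auto intro!: r_into_equivclp gluing.intros)
next
  case (3 y z t c)
  then show ?thesis by (auto intro!: r_into_equivclp gluing.intros)
qed

lemma equivclp_gluing_iff: "equivclp gluing a b \<longleftrightarrow> normal_form a = normal_form b"
proof
  assume "equivclp gluing a b"
  then show "normal_form a = normal_form b"
    by (induction rule: equivclp_induct) (auto dest: gluing_normal_form)
next
  assume "normal_form a = normal_form b"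
  then show "equivclp gluing a b"
    by (metis equivclp_normal_form equivclp_sym equivclp_trans)
qed

lemma normal_form_inj: "normal_form (i, p) = normal_form (i, q) \<Longrightarrow> p = q"
  by (cases i; cases p; cases q) (auto split: if_splits)

lemma normal_form_t_c:
  assumes "normal_form (i, p) = normal_form (j, q)"
  shows "t_of p = t_of q" "c_of p = c_of q"
  using assms by (cases i; cases j; cases p; cases q; auto split: if_splits)+

lemma mem_chart_map_iff: "(j, q) \<in> chart_map i p \<longleftrightarrow> normal_form (j, q) = normal_form (i, p)"
  by (auto simp: chart_map_def glue_rel_def equivclp_gluing_iff)

lemma coord_chart_map [simp]: "coord i (chart_map i p) = p"
  unfolding coord_def mem_chart_map_iff by (blast dest: normal_form_inj)

lemma t_fun_chart_map [simp]: "t_fun (chart_map i p) = t_of p"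
  unfolding t_fun_def mem_chart_map_iff by (blast dest: normal_form_t_c)

lemma c_fun_chart_map [simp]: "c_fun (chart_map i p) = c_of p"
  unfolding c_fun_def mem_chart_map_iff by (blast dest: normal_form_t_c)


section \<open>Zariski topology and regular functions\<close>

definition zariski_open :: "point set \<Rightarrow> bool" where
  "zariski_open V \<longleftrightarrow> V \<subseteq> variety \<and> (\<forall>i. zariski_open4 (chart_map i -` V))"

definition regular_on :: "point set \<Rightarrow> (point \<Rightarrow> complex) \<Rightarrow> bool" where
  "regular_on V f \<longleftrightarrow> zariski_open V \<and>
    (\<forall>i p. chart_map i p \<in> V \<longrightarrow>
      (\<exists>N P Q. zariski_open4 N \<and> p \<in> N \<and> P \<in> poly_fun \<and> Q \<in> poly_fun \<and>
        (\<forall>q\<in>N. Q q \<noteq> 0 \<and> f (chart_map i q) = P q / Q q)))"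

definition regular_at :: "point \<Rightarrow> (point \<Rightarrow> complex) \<Rightarrow> bool" where
  "regular_at x f \<longleftrightarrow> (\<exists>V. x \<in> V \<and> regular_on V f)"


section \<open>Differential forms relative to C[c]\<close>

text \<open>
  A tangent vector at \<open>x\<close> relative to \<open>Spec C[c]\<close> is a \<open>C[c]\<close>-linear derivation from the local ring
  at \<open>x\<close> to the residue field. It is represented as a functional on all functions, which depends
  only on the germ at \<open>x\<close> and, to make the representation unique, vanishes on functions that are
  not regular at \<open>x\<close>.
\<close>

type_synonym tangent = "(point \<Rightarrow> complex) \<Rightarrow> complex"

definition rel_tangent_space :: "point \<Rightarrow> tangent set" where
  "rel_tangent_space x = {D.
     (\<forall>f g. regular_at x f \<longrightarrow> regular_at x g \<longrightarrow>
        D (\<lambda>u. f u + g u) = D f + D g \<and>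
        D (\<lambda>u. f u * g u) = f x * D g + g x * D f) \<and>
     (\<forall>h :: complex poly. D (\<lambda>u. poly h (c_fun u)) = 0) \<and>
     (\<forall>V f g. x \<in> V \<longrightarrow> regular_on V f \<longrightarrow> (\<forall>u\<in>V. f u = g u) \<longrightarrow> D f = D g) \<and>
     (\<forall>f. \<not> regular_at x f \<longrightarrow> D f = 0)}"

type_synonym form1 = "point \<Rightarrow> tangent \<Rightarrow> complex"
type_synonym form2 = "point \<Rightarrow> tangent \<Rightarrow> tangent \<Rightarrow> complex"
type_synonym form3 = "point \<Rightarrow> tangent \<Rightarrow> tangent \<Rightarrow> tangent \<Rightarrow> complex"

definition differential :: "(point \<Rightarrow> complex) \<Rightarrow> form1" where
  "differential f = (\<lambda>x D. D f)"

definition wedge :: "form1 \<Rightarrow> form1 \<Rightarrow> form2" where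
  "wedge \<alpha> \<beta> = (\<lambda>x D E. \<alpha> x D * \<beta> x E - \<alpha> x E * \<beta> x D)"

definition wedge3 :: "form1 \<Rightarrow> form1 \<Rightarrow> form1 \<Rightarrow> form3" where
  "wedge3 \<alpha> \<beta> \<gamma> = (\<lambda>x D E F.
     \<alpha> x D * wedge \<beta> \<gamma> x E F - \<alpha> x E * wedge \<beta> \<gamma> x D F + \<alpha> x F * wedge \<beta> \<gamma> x D E)"

text \<open>\<open>represents2 N n f g h \<omega>\<close>: the 2-form \<open>\<omega>\<close> equals \<open>\<Sum>k<n. f\<^sub>k dg\<^sub>k \<and> dh\<^sub>k\<close> on \<open>N\<close>.\<close>

definition represents2 ::
  "point set \<Rightarrow> nat \<Rightarrow> (nat \<Rightarrow> point \<Rightarrow> complex) \<Rightarrow> (nat \<Rightarrow> point \<Rightarrow> complex) \<Rightarrow>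
   (nat \<Rightarrow> point \<Rightarrow> complex) \<Rightarrow> form2 \<Rightarrow> bool" where
  "represents2 N n f g h \<omega> \<longleftrightarrow>
     (\<forall>k<n. regular_on N (f k) \<and> regular_on N (g k) \<and> regular_on N (h k)) \<and>
     (\<forall>x\<in>N. \<forall>D\<in>rel_tangent_space x. \<forall>E\<in>rel_tangent_space x.
        \<omega> x D E = (\<Sum>k<n. f k x * wedge (differential (g k)) (differential (h k)) x D E))"

text \<open>A form on \<open>V\<close> takes arguments \<open>x \<in> V\<close> and relative tangent vectors at \<open>x\<close>; it is extended by
  zero, so that equality of forms on \<open>V\<close> is equality of functions.\<close>

definition restrict_form :: "point set \<Rightarrow> form2 \<Rightarrow> form2" where
  "restrict_form V \<omega> = (\<lambda>x D E.
     if x \<in> V \<and> D \<in> rel_tangent_space x \<and> E \<in> rel_tangent_space x then \<omega> x D E else 0)"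

definition two_form_on :: "point set \<Rightarrow> form2 \<Rightarrow> bool" where
  "two_form_on V \<omega> \<longleftrightarrow> zariski_open V \<and> restrict_form V \<omega> = \<omega> \<and>
     (\<forall>x\<in>V. \<exists>N n f g h. x \<in> N \<and> N \<subseteq> V \<and> zariski_open N \<and> represents2 N n f g h \<omega>)"

definition has_exterior_derivative :: "point set \<Rightarrow> form2 \<Rightarrow> form3 \<Rightarrow> bool" where
  "has_exterior_derivative V \<omega> \<theta> \<longleftrightarrow>
     (\<forall>x\<in>V. \<exists>N n f g h. x \<in> N \<and> N \<subseteq> V \<and> zariski_open N \<and> represents2 N n f g h \<omega> \<and>
        (\<forall>u\<in>N. \<forall>D\<in>rel_tangent_space u. \<forall>E\<in>rel_tangent_space u. \<forall>F\<in>rel_tangent_space u.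
           \<theta> u D E F =
             (\<Sum>k<n. wedge3 (differential (f k)) (differential (g k)) (differential (h k)) u D E F)))"

definition closed_form_on :: "point set \<Rightarrow> form2 \<Rightarrow> bool" where
  "closed_form_on V \<omega> \<longleftrightarrow> has_exterior_derivative V \<omega> (\<lambda>_ _ _ _. 0)"


section \<open>The Hamiltonians and the 2-forms on the charts\<close>

definition H1 :: "complex \<Rightarrow> complex \<Rightarrow> complex \<Rightarrow> complex \<Rightarrow> complex" where
  "H1 t c y z = y^2 * z + 1/2 * z^2 + t/2 * z - c * y"

definition polynomial4 :: "(complex \<Rightarrow> complex \<Rightarrow> complex \<Rightarrow> complex \<Rightarrow> complex) \<Rightarrow> bool" where
  "polynomial4 F \<longleftrightarrow> (\<lambda>(y, z, t, c). F t c y z) \<in> poly_fun"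

text \<open>The defining formulas of \<open>H3\<close> and \<open>H12\<close> are rational expressions whose denominators cancel; they
  determine the polynomials by their values for \<open>y \<noteq> 0\<close>.\<close>

definition H3 :: "complex \<Rightarrow> complex \<Rightarrow> complex \<Rightarrow> complex \<Rightarrow> complex" where
  "H3 = (THE F. polynomial4 F \<and>
     (\<forall>t c y z. y \<noteq> 0 \<longrightarrow> F t c y z = H1 t c (1 / y) (y * (c - y * z))))"

definition H12 :: "complex \<Rightarrow> complex \<Rightarrow> complex \<Rightarrow> complex \<Rightarrow> complex" where
  "H12 = (THE F. polynomial4 F \<and>
     (\<forall>t c y z. y \<noteq> 0 \<longrightarrow>
        F t c y z = H3 t c y (z + (2 * c + 1) / y + t / y^2 + 2 / y^4) - 1 / y))"

lemma polynomial4_eqI: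
  assumes "polynomial4 F" "polynomial4 G" "\<And>t c y z. y \<noteq> 0 \<Longrightarrow> F t c y z = G t c y z"
  shows "F = G"
proof -
  have cont: "continuous_on UNIV P" if "P \<in> poly_fun" for P
    using that
  proof (induction rule: poly_fun.induct)
    case y
    have "continuous_on UNIV (\<lambda>p :: affine4. fst p)" by (intro continuous_intros)
    moreover have "(\<lambda>p. fst p) = y_of" by auto
    ultimately show ?case by (simp only:)
  next
    case z
    have "continuous_on UNIV (\<lambda>p :: affine4. fst (snd p))" by (intro continuous_intros)
    moreover have "(\<lambda>p. fst (snd p)) = z_of" by auto
    ultimately show ?case by (simp only:)
  next
    case t
    have "continuous_on UNIV (\<lambda>p :: affine4. fst (snd (snd p)))" by (intro continuous_intros)
    moreover have "(\<lambda>p. fst (snd (snd p))) = t_of" by auto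
    ultimately show ?case by (simp only:)
  next
    case c
    have "continuous_on UNIV (\<lambda>p :: affine4. snd (snd (snd p)))" by (intro continuous_intros)
    moreover have "(\<lambda>p. snd (snd (snd p))) = c_of" by auto
    ultimately show ?case by (simp only:)
  qed (intro continuous_intros; assumption)+
  have zero: "F t c 0 z = G t c 0 z" for t c z
  proof -
    define E where "E = (\<lambda>y. F t c y z - G t c y z)"
    define emb where "emb = (\<lambda>y :: complex. (y, z, t, c))"
    have emb: "continuous_on UNIV emb"
      unfolding emb_def by (intro continuous_intros)
    have comp: "continuous_on UNIV (P \<circ> emb)" if "P \<in> poly_fun" for P
      using emb continuous_on_subset[OF cont[OF that]] by (rule continuous_on_compose) simp
    have "continuous_on UNIV
        (\<lambda>y. ((\<lambda>(y, z, t, c). F t c y z) \<circ> emb) y - ((\<lambda>(y, z, t, c). G t c y z) \<circ> emb) y)"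
      using assms(1,2) unfolding polynomial4_def by (intro continuous_on_diff comp)
    hence "continuous_on UNIV E"
      by (simp add: E_def emb_def)
    hence "isCont E 0" by (simp add: continuous_on_eq_continuous_at)
    hence "(E \<longlongrightarrow> E 0) (at 0)" by (simp only: isCont_def)
    moreover have "(E \<longlongrightarrow> 0) (at 0)"
      by (rule tendsto_eventually) (simp add: E_def assms(3) eventually_at_filter)
    ultimately have "E 0 = 0" by (rule tendsto_unique[OF at_neq_bot])
    thus ?thesis by (simp add: E_def)
  qed
  show ?thesis
  proof (intro ext)
    fix t c y z
    show "F t c y z = G t c y z"
      by (cases "y = 0") (simp_all only: zero assms(3) not_False_eq_True)
  qed
qed

lemma H3_eq: "H3 t c y z = 1/2 * y^2 * (c - y * z)^2 + t/2 * y * (c - y * z) - z"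
proof -
  define G :: "complex \<Rightarrow> complex \<Rightarrow> complex \<Rightarrow> complex \<Rightarrow> complex" where
    "G = (\<lambda>t c y z. 1/2 * y^2 * (c - y * z)^2 + t/2 * y * (c - y * z) - z)"
  have poly: "polynomial4 G"
  proof -
    have eq: "(\<lambda>(y, z, t, c). G t c y z) = (\<lambda>p. 1/2 * (y_of p * y_of p *
        ((c_of p + (-1) * (y_of p * z_of p)) * (c_of p + (-1) * (y_of p * z_of p)))) +
        (1/2 * (t_of p * (y_of p * (c_of p + (-1) * (y_of p * z_of p)))) + (-1) * z_of p))"
      by (auto simp: fun_eq_iff G_def power2_eq_square field_simps)
    show ?thesis unfolding polynomial4_def eq by (intro poly_fun.intros)
  qed
  have val: "\<forall>t c y z. y \<noteq> 0 \<longrightarrow> G t c y z = H1 t c (1 / y) (y * (c - y * z))"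
    by (auto simp: G_def H1_def field_simps power2_eq_square)
  have "H3 = G" unfolding H3_def
  proof (rule the_equality)
    fix F assume "polynomial4 F \<and>
      (\<forall>t c y z. y \<noteq> 0 \<longrightarrow> F t c y z = H1 t c (1 / y) (y * (c - y * z)))"
    then show "F = G" using poly val by (intro polynomial4_eqI) auto
  qed (use poly val in blast)
  show ?thesis unfolding \<open>H3 = G\<close> by (simp add: G_def)
qed

lemma H12_eq:
  "H12 t c y z = 1/2 * y^2 * (c + 1 + y * z)^2 + t/2 * y * (c + 1 + y * z) + z"
proof -
  define G :: "complex \<Rightarrow> complex \<Rightarrow> complex \<Rightarrow> complex \<Rightarrow> complex" where
    "G = (\<lambda>t c y z. 1/2 * y^2 * (c + 1 + y * z)^2 + t/2 * y * (c + 1 + y * z) + z)"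
  have poly: "polynomial4 G"
  proof -
    have eq: "(\<lambda>(y, z, t, c). G t c y z) = (\<lambda>p. 1/2 * (y_of p * y_of p *
        ((c_of p + 1 + y_of p * z_of p) * (c_of p + 1 + y_of p * z_of p))) +
        (1/2 * (t_of p * (y_of p * (c_of p + 1 + y_of p * z_of p))) + z_of p))"
      by (auto simp: fun_eq_iff G_def power2_eq_square field_simps)
    show ?thesis unfolding polynomial4_def eq by (intro poly_fun.intros)
  qed
  have val: "\<forall>t c y z. y \<noteq> 0 \<longrightarrow>
      G t c y z = H3 t c y (z + (2 * c + 1) / y + t / y^2 + 2 / y^4) - 1 / y"
  proof (intro allI impI)
    fix t c y z :: complex assume "y \<noteq> 0"
    define v W Z where "v = 1 / y" and "W = y * (c + 1 + y * z)"
      and "Z = z + (2 * c + 1) / y + t / y^2 + 2 / y^4"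
    have yZ: "y * (c - y * Z) = - (W + t + 2 * v^2)"
      using \<open>y \<noteq> 0\<close> by (simp add: v_def W_def Z_def field_simps power2_eq_square power4_eq_xxxx)
    have Z: "Z = z + (2 * c + 1) * v + t * v^2 + 2 * v^4"
      by (simp add: Z_def v_def power_one_over)
    have W: "v^2 * W = z + (c + 1) * v"
      using \<open>y \<noteq> 0\<close> by (simp add: v_def W_def field_simps power2_eq_square)
    have "H3 t c y Z = 1/2 * (y * (c - y * Z))^2 + t/2 * (y * (c - y * Z)) - Z"
      by (simp add: H3_eq power_mult_distrib)
    also have "\<dots> - v = 1/2 * W^2 + t/2 * W + 2 * (v^2 * W) - (z + (2 * c + 1) * v) - v"
      unfolding yZ by (simp add: Z field_simps power2_eq_square power4_eq_xxxx)
    also have "\<dots> = 1/2 * W^2 + t/2 * W + z"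
      unfolding W by (simp add: algebra_simps)
    also have "\<dots> = G t c y z"
      by (simp add: G_def W_def power_mult_distrib)
    finally show "G t c y z = H3 t c y (z + (2 * c + 1) / y + t / y^2 + 2 / y^4) - 1 / y"
      by (simp add: Z_def v_def)
  qed
  have "H12 = G" unfolding H12_def
  proof (rule the_equality)
    fix F assume "polynomial4 F \<and> (\<forall>t c y z. y \<noteq> 0 \<longrightarrow>
        F t c y z = H3 t c y (z + (2 * c + 1) / y + t / y^2 + 2 / y^4) - 1 / y)"
    then show "F = G" using poly val by (intro polynomial4_eqI) auto
  qed (use poly val in blast)
  show ?thesis unfolding \<open>H12 = G\<close> by (simp add: G_def)
qed

fun hamiltonian :: "chart \<Rightarrow> complex \<Rightarrow> complex \<Rightarrow> complex \<Rightarrow> complex \<Rightarrow> complex" where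
  "hamiltonian W1 = H1"
| "hamiltonian W3 = H3"
| "hamiltonian W12 = H12"

definition hamiltonian_fun :: "chart \<Rightarrow> point \<Rightarrow> complex" where
  "hamiltonian_fun i x = hamiltonian i (t_fun x) (c_fun x) (y_coord i x) (z_coord i x)"

definition chart_form :: "chart \<Rightarrow> form2" where
  "chart_form i = restrict_form (chart_dom i) (\<lambda>x D E.
     wedge (differential (y_coord i)) (differential (z_coord i)) x D E +
     wedge (differential (hamiltonian_fun i)) (differential t_fun) x D E)"

end

(*
  All pairwise overlaps of the charts coincide with the locus where y1, y3 and y12 are invertible.
  There, besides the first gluing rule, z3 = z12 + (2c+1) y1 + t y1^2 + 2 y1^4, H1 = H3 and
  H12 = H3 - y1 hold, so differentiating (with dc = 0) yields
    dy1 /\ dz1 = dy3 /\ dz3   and   dy3 /\ dz3 = dy12 /\ dz12 - dy1 /\ dt,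
  and the last term is compensated by dH3 /\ dt = dH12 /\ dt + dy1 /\ dt.
*)
theory Submission
  imports Defs
begin

section \<open>Zariski-open sets\<close>

lemma zariski_open4_UNIV: "zariski_open4 UNIV"
  unfolding zariski_open4_def
  by (rule exI[of _ "{\<lambda>_. 1}"]) (auto intro: poly_fun.intros)

lemma zariski_open4_nonzero:
  assumes "P \<in> poly_fun"
  shows "zariski_open4 {p. P p \<noteq> 0}"
  unfolding zariski_open4_def using assms by (intro exI[of _ "{P}"]) auto

text \<open>As the field has no zero divisors, the products of one polynomial from each defining
  family have the intersection as their non-vanishing locus.\<close>

lemma zariski_open4_Int:
  assumes "zariski_open4 S" "zariski_open4 T"
  shows "zariski_open4 (S \<inter> T)"
proof -
  obtain F G where F: "F \<subseteq> poly_fun" "S = {p. \<exists>P\<in>F. P p \<noteq> 0}"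
    and G: "G \<subseteq> poly_fun" "T = {p. \<exists>P\<in>G. P p \<noteq> 0}"
    using assms unfolding zariski_open4_def by blast
  let ?H = "{\<lambda>p. P p * Q p |P Q. P \<in> F \<and> Q \<in> G}"
  have "?H \<subseteq> poly_fun" using F(1) G(1) by (auto intro: poly_fun.mult)
  moreover have "S \<inter> T = {p. \<exists>P\<in>?H. P p \<noteq> 0}"
    unfolding F(2) G(2) by (auto; force)
  ultimately show ?thesis unfolding zariski_open4_def by blast
qed

lemma zariski_open_Int: "zariski_open U \<Longrightarrow> zariski_open V \<Longrightarrow> zariski_open (U \<inter> V)"
  unfolding zariski_open_def by (auto simp: zariski_open4_Int)

lemma variety_eq: "variety = (\<Union>i. chart_dom i)"
  unfolding variety_def chart_dom_def chart_map_def quotient_def by auto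

section \<open>Transition maps and overlaps of the charts\<close>

lemma chart_map_eq_iff:
  "chart_map i p = chart_map j q \<longleftrightarrow> normal_form (i, p) = normal_form (j, q)"
proof
  assume "chart_map i p = chart_map j q"
  then have "(i, p) \<in> chart_map j q" using mem_chart_map_iff[of i p i p] by blast
  then show "normal_form (i, p) = normal_form (j, q)" by (simp only: mem_chart_map_iff)
next
  assume eq: "normal_form (i, p) = normal_form (j, q)"
  have "(k, r) \<in> chart_map i p \<longleftrightarrow> (k, r) \<in> chart_map j q" for k r
    by (simp only: mem_chart_map_iff eq)
  then show "chart_map i p = chart_map j q" by (intro set_eqI) (metis surj_pair)
qed

text \<open>The gluing rules, solved for the coordinates of either chart. Comparing normal forms
  reduces each of them to algebra with \<open>y\<close> invertible.\<close>

lemma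
  assumes "y \<noteq> 0"
  shows chart_map_W3_W1: "chart_map W3 (y, z, t, c) = chart_map W1 (1 / y, y * (c - y * z), t, c)"
    and chart_map_W12_W1: "chart_map W12 (y, z, t, c) =
      chart_map W1 (1 / y, y * (- (c + 1) - y * z) - 2 * (1 / y)^2 - t, t, c)"
    and chart_map_W1_W3: "chart_map W1 (y, z, t, c) = chart_map W3 (1 / y, y * (c - y * z), t, c)"
    and chart_map_W1_W12: "chart_map W1 (y, z, t, c) =
      chart_map W12 (1 / y, y * (- (c + 1) - y * (z + 2 * y^2 + t)), t, c)"
    and chart_map_W12_W3: "chart_map W12 (y, z, t, c) =
      chart_map W3 (y, z + (2 * c + 1) / y + t / y^2 + 2 / y^4, t, c)"
    and chart_map_W3_W12: "chart_map W3 (y, z, t, c) =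
      chart_map W12 (y, z - (2 * c + 1) / y - t / y^2 - 2 / y^4, t, c)"
  using assms
  by (auto simp: chart_map_eq_iff field_simps power2_eq_square power4_eq_xxxx)

text \<open>Once the point is rewritten in the target chart, \<open>coord_chart_map\<close> reads
  off its coordinates. The results show which powers of \<open>y\<close> occur as denominators of
  the coordinate functions.\<close>

lemma coord_chart_map_transition:
  assumes "y \<noteq> 0"
  shows "coord W1 (chart_map W3 (y, z, t, c)) = (1 / y, y * (c - y * z), t, c)"
    and "coord W1 (chart_map W12 (y, z, t, c)) =
      (1 / y, y * (- (c + 1) - y * z) - 2 * (1 / y)^2 - t, t, c)"
    and "coord W3 (chart_map W1 (y, z, t, c)) = (1 / y, y * (c - y * z), t, c)"
    and "coord W12 (chart_map W1 (y, z, t, c)) =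
      (1 / y, y * (- (c + 1) - y * (z + 2 * y^2 + t)), t, c)"
    and "coord W3 (chart_map W12 (y, z, t, c)) =
      (y, z + (2 * c + 1) / y + t / y^2 + 2 / y^4, t, c)"
    and "coord W12 (chart_map W3 (y, z, t, c)) =
      (y, z - (2 * c + 1) / y - t / y^2 - 2 / y^4, t, c)"
  by (simp only: chart_map_W3_W1[OF assms] coord_chart_map)
    (simp only: chart_map_W12_W1[OF assms] coord_chart_map,
     simp only: chart_map_W1_W3[OF assms] coord_chart_map,
     simp only: chart_map_W1_W12[OF assms] coord_chart_map,
     simp only: chart_map_W12_W3[OF assms] coord_chart_map,
     simp only: chart_map_W3_W12[OF assms] coord_chart_map)

text \<open>A point with \<open>y = 0\<close> is its own normal form, and no point of another chart
  shares it. For \<open>W1\<close> this is so because the points that \<open>normal_form\<close>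
  moves there have an inverse as first coordinate, which is never 0.\<close>

lemma chart_map_in_chart_dom_iff:
  "chart_map j p \<in> chart_dom i \<longleftrightarrow> i = j \<or> y_of p \<noteq> 0"
proof
  assume "chart_map j p \<in> chart_dom i"
  then obtain q where "normal_form (j, p) = normal_form (i, q)"
    unfolding chart_dom_def by (auto simp: chart_map_eq_iff)
  then show "i = j \<or> y_of p \<noteq> 0"
    by (cases i; cases j; cases p; cases q) (auto split: if_splits)
next
  assume *: "i = j \<or> y_of p \<noteq> 0"
  obtain y z t c where p: "p = (y, z, t, c)" by (cases p)
  have "\<exists>q. chart_map j p = chart_map i q"
  proof (cases "i = j")
    case False
    with * have y: "y \<noteq> 0" by (simp add: p)
    note transitions = chart_map_W3_W1[OF y] chart_map_W12_W1[OF y] chart_map_W1_W3[OF y]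
      chart_map_W1_W12[OF y] chart_map_W12_W3[OF y] chart_map_W3_W12[OF y]
    show ?thesis
      unfolding p by (cases i; cases j; simp only:; rule exI; rule refl transitions)
  qed blast
  then show "chart_map j p \<in> chart_dom i"
    unfolding chart_dom_def by auto
qed

lemma vimage_chart_dom: "chart_map j -` chart_dom i = (if i = j then UNIV else {p. y_of p \<noteq> 0})"
  by (rule set_eqI) (simp add: chart_map_in_chart_dom_iff)

lemma zariski_open_chart_dom: "zariski_open (chart_dom i)"
proof -
  have "chart_dom i \<subseteq> variety" unfolding variety_eq by blast
  then show ?thesis
    by (simp add: zariski_open_def vimage_chart_dom zariski_open4_UNIV
        zariski_open4_nonzero[OF poly_fun.y])
qed

lemma zariski_open_variety: "zariski_open variety"
proof -
  have "chart_map i -` variety = UNIV" for i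
    by (auto simp: variety_eq chart_dom_def)
  then show ?thesis by (simp add: zariski_open_def zariski_open4_UNIV)
qed

section \<open>Regular functions on the glued variety\<close>

lemma regular_onI:
  assumes "zariski_open V"
    and "\<And>j. \<exists>P\<in>poly_fun. \<exists>Q\<in>poly_fun. \<forall>q. chart_map j q \<in> V \<longrightarrow>
      Q q \<noteq> 0 \<and> f (chart_map j q) = P q / Q q"
  shows "regular_on V f"
  unfolding regular_on_def
proof (intro conjI allI impI)
  fix j p assume p: "chart_map j p \<in> V"
  obtain P Q where "P \<in> poly_fun" "Q \<in> poly_fun"
    "\<forall>q. chart_map j q \<in> V \<longrightarrow> Q q \<noteq> 0 \<and> f (chart_map j q) = P q / Q q"
    using assms(2) by blast
  moreover have "zariski_open4 (chart_map j -` V)"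
    using assms(1) by (simp add: zariski_open_def)
  ultimately show "\<exists>N P Q. zariski_open4 N \<and> p \<in> N \<and> P \<in> poly_fun \<and> Q \<in> poly_fun \<and>
      (\<forall>q\<in>N. Q q \<noteq> 0 \<and> f (chart_map j q) = P q / Q q)"
    \<comment> \<open>The full preimage of \<open>V\<close> is the neighbourhood, so one fraction
      per chart serves all points.\<close>
    using p by (intro exI[of _ "chart_map j -` V"] exI[of _ P] exI[of _ Q]) auto
qed (rule assms(1))

lemma regular_on_zariski_open: "regular_on V f \<Longrightarrow> zariski_open V"
  by (simp add: regular_on_def)

lemma regular_on_subset:
  assumes "regular_on V f" "zariski_open U" "U \<subseteq> V"
  shows "regular_on U f"
  using assms unfolding regular_on_def by blast

text \<open>Meant for functions given by the same polynomial in all charts: constants,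
  \<open>t_fun\<close> and \<open>c_fun\<close>.\<close>

lemma regular_on_polyI:
  assumes "zariski_open V" "P \<in> poly_fun" "\<And>j q. f (chart_map j q) = P q"
  shows "regular_on V f"
  by (rule regular_onI[OF assms(1)], rule bexI[OF _ assms(2)],
      rule bexI[OF _ poly_fun.const[of 1]]) (simp add: assms(3))

lemma regular_on_const: "zariski_open V \<Longrightarrow> regular_on V (\<lambda>_. a)"
  by (rule regular_on_polyI[OF _ poly_fun.const]) auto

lemma regular_on_t_fun: "zariski_open V \<Longrightarrow> regular_on V t_fun"
  by (rule regular_on_polyI[OF _ poly_fun.t]) auto

lemma regular_on_c_fun: "zariski_open V \<Longrightarrow> regular_on V c_fun"
  by (rule regular_on_polyI[OF _ poly_fun.c]) auto

lemma
  assumes "regular_on V f" "regular_on V g"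
  shows regular_on_add: "regular_on V (\<lambda>u. f u + g u)"
    and regular_on_mult: "regular_on V (\<lambda>u. f u * g u)"
proof -
  have V: "zariski_open V" using assms(1) by (rule regular_on_zariski_open)
  \<comment> \<open>Both functions become fractions on one common neighbourhood, where sum and
    product are formed over the denominator \<open>Q q * Q' q\<close>.\<close>
  have common: "\<exists>N P Q P' Q'. zariski_open4 N \<and> p \<in> N \<and> P \<in> poly_fun \<and> Q \<in> poly_fun \<and>
      P' \<in> poly_fun \<and> Q' \<in> poly_fun \<and> (\<forall>q\<in>N. Q q \<noteq> 0 \<and> Q' q \<noteq> 0 \<and>
        f (chart_map i q) = P q / Q q \<and> g (chart_map i q) = P' q / Q' q)"
    if p: "chart_map i p \<in> V" for i p
  proof -
    obtain N P Q where 1: "zariski_open4 N" "p \<in> N" "P \<in> poly_fun" "Q \<in> poly_fun"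
      "\<forall>q\<in>N. Q q \<noteq> 0 \<and> f (chart_map i q) = P q / Q q"
      using assms(1) p unfolding regular_on_def by meson
    obtain N' P' Q' where 2: "zariski_open4 N'" "p \<in> N'" "P' \<in> poly_fun" "Q' \<in> poly_fun"
      "\<forall>q\<in>N'. Q' q \<noteq> 0 \<and> g (chart_map i q) = P' q / Q' q"
      using assms(2) p unfolding regular_on_def by meson
    show ?thesis
      by (rule exI[of _ "N \<inter> N'"], rule exI[of _ P], rule exI[of _ Q], rule exI[of _ P'],
          rule exI[of _ Q']) (use 1 2 in \<open>auto simp: zariski_open4_Int\<close>)
  qed
  show "regular_on V (\<lambda>u. f u + g u)"
    unfolding regular_on_def
  proof (intro conjI allI impI V)
    fix i p assume "chart_map i p \<in> V"
    from common[OF this] obtain N P Q P' Q' where *: "zariski_open4 N" "p \<in> N" "P \<in> poly_fun" "Q \<in> poly_fun"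
      "P' \<in> poly_fun" "Q' \<in> poly_fun" "\<forall>q\<in>N. Q q \<noteq> 0 \<and> Q' q \<noteq> 0 \<and>
        f (chart_map i q) = P q / Q q \<and> g (chart_map i q) = P' q / Q' q"
      by (elim exE conjE) (rule that)
    show "\<exists>N P Q. zariski_open4 N \<and> p \<in> N \<and> P \<in> poly_fun \<and> Q \<in> poly_fun \<and>
        (\<forall>q\<in>N. Q q \<noteq> 0 \<and> f (chart_map i q) + g (chart_map i q) = P q / Q q)"
      by (rule exI[of _ N], rule exI[of _ "\<lambda>q. P q * Q' q + P' q * Q q"],
          rule exI[of _ "\<lambda>q. Q q * Q' q"])
        (use * in \<open>auto intro!: poly_fun.intros simp: add_frac_eq\<close>)
  qed
  show "regular_on V (\<lambda>u. f u * g u)"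
    unfolding regular_on_def
  proof (intro conjI allI impI V)
    fix i p assume "chart_map i p \<in> V"
    from common[OF this] obtain N P Q P' Q' where *: "zariski_open4 N" "p \<in> N" "P \<in> poly_fun" "Q \<in> poly_fun"
      "P' \<in> poly_fun" "Q' \<in> poly_fun" "\<forall>q\<in>N. Q q \<noteq> 0 \<and> Q' q \<noteq> 0 \<and>
        f (chart_map i q) = P q / Q q \<and> g (chart_map i q) = P' q / Q' q"
      by (elim exE conjE) (rule that)
    show "\<exists>N P Q. zariski_open4 N \<and> p \<in> N \<and> P \<in> poly_fun \<and> Q \<in> poly_fun \<and>
        (\<forall>q\<in>N. Q q \<noteq> 0 \<and> f (chart_map i q) * g (chart_map i q) = P q / Q q)"
      by (rule exI[of _ N], rule exI[of _ "\<lambda>q. P q * P' q"], rule exI[of _ "\<lambda>q. Q q * Q' q"])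
        (use * in \<open>auto intro!: poly_fun.intros\<close>)
  qed
qed

lemma poly_fun_diff:
  assumes "P \<in> poly_fun" "Q \<in> poly_fun"
  shows "(\<lambda>p. P p - Q p) \<in> poly_fun"
  using poly_fun.add[OF assms(1) poly_fun.mult[OF poly_fun.const[of "-1"] assms(2)]] by simp

lemma poly_fun_power: "P \<in> poly_fun \<Longrightarrow> (\<lambda>p. P p ^ n) \<in> poly_fun"
  by (induction n) (simp_all add: poly_fun.const poly_fun.mult)

lemmas poly_fun_intros = poly_fun.intros poly_fun_diff poly_fun_power

lemma regular_on_y_coord: "regular_on (chart_dom i) (y_coord i)"
proof (rule regular_onI[OF zariski_open_chart_dom])
  fix j
  \<comment> \<open>\<open>W3\<close> and \<open>W12\<close> share their \<open>y\<close>
    coordinate, and that of \<open>W1\<close> is its inverse. Hence only the fractions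
    \<open>y / 1\<close> and \<open>1 / y\<close> occur.\<close>
  consider "i = j \<or> i \<noteq> W1 \<and> j \<noteq> W1" | "i \<noteq> j" "i = W1 \<or> j = W1" by blast
  then show "\<exists>P\<in>poly_fun. \<exists>Q\<in>poly_fun. \<forall>q. chart_map j q \<in> chart_dom i \<longrightarrow>
      Q q \<noteq> 0 \<and> y_coord i (chart_map j q) = P q / Q q"
  proof cases
    case 1
    show ?thesis
      by (rule bexI[of _ y_of], rule bexI[of _ "\<lambda>_. 1"])
        (use 1 in \<open>cases i; cases j; auto simp: y_coord_def chart_map_in_chart_dom_iff
          coord_chart_map_transition intro: poly_fun.intros\<close>)+
  next
    case 2
    show ?thesis
      by (rule bexI[of _ "\<lambda>_. 1"], rule bexI[of _ y_of])
        (use 2 in \<open>cases i; cases j; auto simp: y_coord_def chart_map_in_chart_dom_iff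
          coord_chart_map_transition intro: poly_fun.intros\<close>)+
  qed
qed

lemma regular_on_z_coord: "regular_on (chart_dom i) (z_coord i)"
proof (rule regular_onI[OF zariski_open_chart_dom])
  fix j
  \<comment> \<open>The transition formulas multiplied by y^4, which clears every denominator, the
    worst being the one of 2 / y^4. A difference \<open>0 - (c_of p + 1)\<close> replaces the
    negation so that the closure rules for polynomial functions match.\<close>
  define P where "P = (\<lambda>p. case (i, j) of
      (W1, W3) \<Rightarrow> y_of p^4 * (y_of p * (c_of p - y_of p * z_of p))
    | (W1, W12) \<Rightarrow> y_of p^4 * (y_of p * (0 - (c_of p + 1) - y_of p * z_of p) - t_of p) - 2 * y_of p^2
    | (W3, W1) \<Rightarrow> y_of p^4 * (y_of p * (c_of p - y_of p * z_of p))
    | (W12, W1) \<Rightarrow> y_of p^4 * (y_of p * (0 - (c_of p + 1) - y_of p * (z_of p + 2 * y_of p^2 + t_of p)))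
    | (W3, W12) \<Rightarrow> y_of p^4 * z_of p + (2 * c_of p + 1) * y_of p^3 + t_of p * y_of p^2 + 2
    | (W12, W3) \<Rightarrow> y_of p^4 * z_of p - (2 * c_of p + 1) * y_of p^3 - t_of p * y_of p^2 - 2
    | _ \<Rightarrow> z_of p)"
  define Q where "Q = (\<lambda>p. if i = j then 1 else y_of p ^ 4)"
  have "P \<in> poly_fun"
    unfolding P_def by (cases i; cases j; simp only: prod.case chart.case; intro poly_fun_intros)
  moreover have "Q \<in> poly_fun"
    unfolding Q_def by (cases "i = j"; simp only: if_True if_False simp_thms; intro poly_fun_intros)
  moreover have "\<forall>q. chart_map j q \<in> chart_dom i \<longrightarrow>
      Q q \<noteq> 0 \<and> z_coord i (chart_map j q) = P q / Q q"
    by (cases i; cases j)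
      (auto simp: P_def Q_def z_coord_def chart_map_in_chart_dom_iff
        coord_chart_map_transition field_simps power2_eq_square power4_eq_xxxx power3_eq_cube)
  ultimately show "\<exists>P\<in>poly_fun. \<exists>Q\<in>poly_fun. \<forall>q. chart_map j q \<in> chart_dom i \<longrightarrow>
      Q q \<noteq> 0 \<and> z_coord i (chart_map j q) = P q / Q q"
    by blast
qed

lemma regular_on_cmult:
  assumes "regular_on V f"
  shows "regular_on V (\<lambda>u. a * f u)"
  by (rule regular_on_mult[OF regular_on_const[OF regular_on_zariski_open[OF assms]] assms])

lemma regular_on_uminus: "regular_on V f \<Longrightarrow> regular_on V (\<lambda>u. - f u)"
  using regular_on_cmult[of V f "-1"] by simp

lemma regular_on_diff: "regular_on V f \<Longrightarrow> regular_on V g \<Longrightarrow> regular_on V (\<lambda>u. f u - g u)"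
  using regular_on_add[OF _ regular_on_uminus] by simp

lemma regular_on_divide_const: "regular_on V f \<Longrightarrow> regular_on V (\<lambda>u. f u / a)"
  using regular_on_cmult[of V f "1 / a"] by simp

lemma regular_on_power:
  assumes "regular_on V f"
  shows "regular_on V (\<lambda>u. f u ^ n)"
  by (induction n)
    (simp_all add: assms regular_on_mult regular_on_const[OF regular_on_zariski_open[OF assms]])

text \<open>The expanded polynomials are used, because the rational defining expressions say nothing
  directly about points with \<open>y = 0\<close>.\<close>

lemma regular_on_hamiltonian_fun: "regular_on (chart_dom i) (hamiltonian_fun i)"
proof -
  note intros = regular_on_add regular_on_mult regular_on_diff regular_on_power
    regular_on_divide_const regular_on_const[OF zariski_open_chart_dom] regular_on_t_fun[OF zariski_open_chart_dom]
    regular_on_c_fun[OF zariski_open_chart_dom] regular_on_y_coord regular_on_z_coord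
  show ?thesis
    unfolding hamiltonian_fun_def[abs_def]
    by (cases i; simp only: hamiltonian.simps H1_def H3_eq H12_eq; intro intros)
qed

section \<open>Calculus of relative tangent vectors\<close>

lemma
  assumes "D \<in> rel_tangent_space x"
  shows tangent_const: "D (\<lambda>_. a) = 0"
    and tangent_c_fun: "D c_fun = 0"
proof -
  have *: "D (\<lambda>u. poly h (c_fun u)) = 0" for h
    using assms by (simp add: rel_tangent_space_def)
  \<comment> \<open>Constants and \<open>c_fun\<close> itself are polynomials in
    \<open>c_fun\<close>, of degree at most 0 and 1, so both are killed by linearity over
    C[c].\<close>
  show "D (\<lambda>_. a) = 0" using *[of "[:a:]"] by simp
  show "D c_fun = 0" using *[of "[:0, 1:]"] by simp
qed

text \<open>The derivation axioms relative to one open set \<open>V\<close> containing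
  \<open>x\<close>. By locality, an identity that holds only on \<open>V\<close> may be
  differentiated at \<open>x\<close>.\<close>

lemma
  assumes "D \<in> rel_tangent_space x" "x \<in> V" "regular_on V f"
  shows tangent_cong: "(\<And>u. u \<in> V \<Longrightarrow> f u = g u) \<Longrightarrow> D f = D g"
    and tangent_add: "regular_on V g \<Longrightarrow> D (\<lambda>u. f u + g u) = D f + D g"
    and tangent_mult: "regular_on V g \<Longrightarrow> D (\<lambda>u. f u * g u) = f x * D g + g x * D f"
  using assms unfolding rel_tangent_space_def regular_at_def by blast+

text \<open>Subtraction is addition of the product with the constant -1, whose derivative
  vanishes.\<close>

lemma tangent_diff:
  assumes D: "D \<in> rel_tangent_space x" and x: "x \<in> V"
    and f: "regular_on V f" and g: "regular_on V g"
  shows "D (\<lambda>u. f u - g u) = D f - D g"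
proof -
  have "D (\<lambda>u. - 1 * g u) = - D g"
    using tangent_mult[OF D x regular_on_const[OF regular_on_zariski_open[OF f], of "- 1"] g]
    by (simp add: tangent_const[OF D])
  then show ?thesis
    using tangent_add[OF D x f regular_on_cmult[OF g, of "- 1"]] by simp
qed

section \<open>Relations between functions and differentials on the overlap\<close>

lemma chart_dom_Int:
  assumes "i \<noteq> j"
  shows "chart_dom i \<inter> chart_dom j = chart_dom W1 \<inter> chart_dom W3 \<inter> chart_dom W12"
proof (intro set_eqI iffI)
  fix x assume x: "x \<in> chart_dom i \<inter> chart_dom j"
  then obtain p where "x = chart_map i p" by (auto simp: chart_dom_def)
  \<comment> \<open>Lying in a chart other than \<open>i\<close> means
    \<open>y_of p \<noteq> 0\<close>, a condition that does not depend on which other chart is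
    taken.\<close>
  with x assms show "x \<in> chart_dom W1 \<inter> chart_dom W3 \<inter> chart_dom W12"
    by (auto simp: chart_map_in_chart_dom_iff)
next
  fix x assume "x \<in> chart_dom W1 \<inter> chart_dom W3 \<inter> chart_dom W12"
  then show "x \<in> chart_dom i \<inter> chart_dom j"
    by (cases i; cases j) auto
qed

text \<open>\<open>H12\<close> is a definite description, so the relation it prescribes is regained
  from its closed form.\<close>

lemma H12_eq_H3:
  assumes "y \<noteq> 0"
  shows "H12 t c y z = H3 t c y (z + (2 * c + 1) / y + t / y^2 + 2 / y^4) - 1 / y"
proof -
  \<comment> \<open>\<open>v\<close> is the pole, and \<open>H12\<close> is W^2/2 + tW/2 + z. By
    \<open>yZ\<close> the second coordinate in \<open>W1\<close> is -(W + t + 2v^2). Expanding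
    \<open>H3\<close> there leaves 2v^2 W as the only term mixing \<open>v\<close> and
    \<open>W\<close>, and rewriting v^2 W as z + (c + 1)v cancels the remaining poles.\<close>
  define v W Z where "v = 1 / y" and "W = y * (c + 1 + y * z)"
    and "Z = z + (2 * c + 1) / y + t / y^2 + 2 / y^4"
  have yZ: "y * (c - y * Z) = - (W + t + 2 * v^2)"
    using assms by (simp add: v_def W_def Z_def field_simps power2_eq_square power4_eq_xxxx)
  have Z: "Z = z + (2 * c + 1) * v + t * v^2 + 2 * v^4"
    by (simp add: Z_def v_def power_one_over)
  have W: "v^2 * W = z + (c + 1) * v"
    using assms by (simp add: v_def W_def field_simps power2_eq_square)
  have "H3 t c y Z - v = 1/2 * (y * (c - y * Z))^2 + t/2 * (y * (c - y * Z)) - Z - v"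
    by (simp add: H3_eq power_mult_distrib)
  also have "\<dots> = 1/2 * W^2 + t/2 * W + 2 * (v^2 * W) - (z + (2 * c + 1) * v) - v"
    unfolding yZ by (simp add: Z field_simps power2_eq_square power4_eq_xxxx)
  also have "\<dots> = 1/2 * W^2 + t/2 * W + z"
    unfolding W by (simp add: algebra_simps)
  also have "\<dots> = H12 t c y z"
    by (simp add: H12_eq W_def power_mult_distrib)
  finally show ?thesis by (simp add: Z_def v_def)
qed

text \<open>The relations contain only sums, differences and products, with
  \<open>y_coord W1\<close> in place of the inverse of \<open>y_coord W12\<close>. In this form the
  derivation rules apply to them term by term.\<close>

lemma overlap_relations:
  assumes "x \<in> chart_dom W1 \<inter> chart_dom W3 \<inter> chart_dom W12"
  shows "y_coord W1 x * y_coord W3 x = 1"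
    and "z_coord W1 x = y_coord W3 x * (c_fun x - y_coord W3 x * z_coord W3 x)"
    and "y_coord W12 x = y_coord W3 x"
    and "z_coord W3 x = z_coord W12 x + (2 * c_fun x + 1) * y_coord W1 x +
      t_fun x * (y_coord W1 x * y_coord W1 x) +
      2 * ((y_coord W1 x * y_coord W1 x) * (y_coord W1 x * y_coord W1 x))"
    and "hamiltonian_fun W1 x = hamiltonian_fun W3 x"
    and "hamiltonian_fun W12 x = hamiltonian_fun W3 x - y_coord W1 x"
proof -
  \<comment> \<open>The overlap is parametrized by \<open>W12\<close>; passing to \<open>W3\<close>
    and then to \<open>W1\<close> yields the other coordinates.\<close>
  obtain y z t c where x: "x = chart_map W12 (y, z, t, c)"
    using assms unfolding chart_dom_def by auto
  then have y: "y \<noteq> 0" using assms by (auto simp: chart_map_in_chart_dom_iff)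
  define z3 where "z3 = z + (2 * c + 1) / y + t / y^2 + 2 / y^4"
  have x3: "x = chart_map W3 (y, z3, t, c)"
    using x y by (simp add: chart_map_W12_W3 z3_def)
  have x1: "x = chart_map W1 (1 / y, y * (c - y * z3), t, c)"
    unfolding x3 using y by (rule chart_map_W3_W1)
  have tc: "t_fun x = t" "c_fun x = c" by (simp_all add: x)
  have c12: "y_coord W12 x = y" "z_coord W12 x = z"
    by (simp_all add: x y_coord_def z_coord_def)
  have c3: "y_coord W3 x = y" "z_coord W3 x = z3"
    by (simp_all add: x3 y_coord_def z_coord_def)
  have c1: "y_coord W1 x = 1 / y" "z_coord W1 x = y * (c - y * z3)"
    by (simp_all only: x1 y_coord_def z_coord_def coord_chart_map y_of.simps z_of.simps)
  show "y_coord W1 x * y_coord W3 x = 1" using y by (simp add: c1 c3)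
  show "z_coord W1 x = y_coord W3 x * (c_fun x - y_coord W3 x * z_coord W3 x)"
    by (simp add: c1 c3 tc)
  show "y_coord W12 x = y_coord W3 x" by (simp add: c12 c3)
  show "z_coord W3 x = z_coord W12 x + (2 * c_fun x + 1) * y_coord W1 x +
      t_fun x * (y_coord W1 x * y_coord W1 x) +
      2 * ((y_coord W1 x * y_coord W1 x) * (y_coord W1 x * y_coord W1 x))"
    by (simp add: c1 c3 c12 tc z3_def power2_eq_square power4_eq_xxxx mult.assoc)
  show "hamiltonian_fun W1 x = hamiltonian_fun W3 x"
    using y by (simp add: hamiltonian_fun_def c1 c3 tc H1_def H3_eq field_simps power2_eq_square)
  show "hamiltonian_fun W12 x = hamiltonian_fun W3 x - y_coord W1 x"
    by (simp add: hamiltonian_fun_def c1 c3 c12 tc z3_def H12_eq_H3[OF y])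
qed

text \<open>The overlap is open and all functions involved are regular on it, so each of the
  preceding relations can be differentiated at \<open>x\<close>.\<close>

lemma overlap_differentials:
  assumes x: "x \<in> chart_dom W1 \<inter> chart_dom W3 \<inter> chart_dom W12"
    and D: "D \<in> rel_tangent_space x"
  shows "D (y_coord W1) = - ((y_coord W1 x)^2 * D (y_coord W3))"
    and "D (z_coord W1) = (c_fun x - 2 * y_coord W3 x * z_coord W3 x) * D (y_coord W3)
      - (y_coord W3 x)^2 * D (z_coord W3)"
    and "D (y_coord W12) = D (y_coord W3)"
    and "D (z_coord W3) = D (z_coord W12)
      + (2 * c_fun x + 1 + 2 * t_fun x * y_coord W1 x + 8 * (y_coord W1 x)^3) * D (y_coord W1)
      + (y_coord W1 x)^2 * D t_fun"
    and "D (hamiltonian_fun W1) = D (hamiltonian_fun W3)"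
    and "D (hamiltonian_fun W12) = D (hamiltonian_fun W3) - D (y_coord W1)"
proof -
  let ?V = "chart_dom W1 \<inter> chart_dom W3 \<inter> chart_dom W12"
  have V: "zariski_open ?V" by (intro zariski_open_Int zariski_open_chart_dom)
  have reg: "regular_on ?V (y_coord i)" "regular_on ?V (z_coord i)"
    "regular_on ?V (hamiltonian_fun i)" for i
    by (cases i; rule regular_on_subset[OF _ V],
        rule regular_on_y_coord regular_on_z_coord regular_on_hamiltonian_fun, blast)+
  note regs = reg regular_on_t_fun[OF V] regular_on_c_fun[OF V] regular_on_const[OF V]
    regular_on_add regular_on_mult regular_on_diff
  note cong = tangent_cong[OF D x]
  note rules = tangent_add[OF D x] tangent_mult[OF D x] tangent_diff[OF D x]
    tangent_const[OF D] tangent_c_fun[OF D]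
  have "D (\<lambda>u. y_coord W1 u * y_coord W3 u) = D (\<lambda>_. 1)"
    by (rule cong[OF regular_on_mult[OF reg(1) reg(1)]]) (rule overlap_relations(1))
  then have "y_coord W1 x * D (y_coord W3) + y_coord W3 x * D (y_coord W1) = 0"
    by (simp add: rules regs)
  then show "D (y_coord W1) = - ((y_coord W1 x)^2 * D (y_coord W3))"
    \<comment> \<open>Multiplication by \<open>y_coord W1 x\<close> solves for the differential of
      \<open>y_coord W1\<close>.\<close>
    using overlap_relations(1)[OF x] by algebra
  have "D (z_coord W1) = D (\<lambda>u. y_coord W3 u * (c_fun u - y_coord W3 u * z_coord W3 u))"
    by (rule cong[OF reg(2)]) (rule overlap_relations(2))
  then show "D (z_coord W1) = (c_fun x - 2 * y_coord W3 x * z_coord W3 x) * D (y_coord W3)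
      - (y_coord W3 x)^2 * D (z_coord W3)"
    \<comment> \<open>The first simplification differentiates the expression as written, the second
      does the ring algebra.\<close>
    by (simp add: rules regs) (simp add: algebra_simps power2_eq_square)
  show "D (y_coord W12) = D (y_coord W3)"
    by (rule cong[OF reg(1)]) (rule overlap_relations(3))
  have "D (z_coord W3) = D (\<lambda>u. z_coord W12 u + (2 * c_fun u + 1) * y_coord W1 u +
      t_fun u * (y_coord W1 u * y_coord W1 u) +
      2 * ((y_coord W1 u * y_coord W1 u) * (y_coord W1 u * y_coord W1 u)))"
    by (rule cong[OF reg(2)]) (rule overlap_relations(4))
  then show "D (z_coord W3) = D (z_coord W12)
      + (2 * c_fun x + 1 + 2 * t_fun x * y_coord W1 x + 8 * (y_coord W1 x)^3) * D (y_coord W1)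
      + (y_coord W1 x)^2 * D t_fun"
    by (simp add: rules regs) (simp add: algebra_simps power2_eq_square power3_eq_cube)
  show "D (hamiltonian_fun W1) = D (hamiltonian_fun W3)"
    by (rule cong[OF reg(3)]) (rule overlap_relations(5))
  have "D (hamiltonian_fun W12) = D (\<lambda>u. hamiltonian_fun W3 u - y_coord W1 u)"
    by (rule cong[OF reg(3)]) (rule overlap_relations(6))
  then show "D (hamiltonian_fun W12) = D (hamiltonian_fun W3) - D (y_coord W1)"
    by (simp add: rules regs)
qed

text \<open>\<open>W3\<close> is the reference chart because the differentials of both other charts
  were related to its own. For arguments that are not tangent vectors both sides are 0 by
  convention.\<close>

lemma chart_form_overlap:
  assumes x: "x \<in> chart_dom W1 \<inter> chart_dom W3 \<inter> chart_dom W12"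
  shows "chart_form i x D E = chart_form W3 x D E"
proof (cases "D \<in> rel_tangent_space x \<and> E \<in> rel_tangent_space x")
  case True
  note d = overlap_differentials[OF x conjunct1[OF True]]
    and e = overlap_differentials[OF x conjunct2[OF True]]
  have inv: "y_coord W1 x * y_coord W3 x = 1" by (rule overlap_relations(1)[OF x])
  have form: "chart_form k x D E = D (y_coord k) * E (z_coord k) - E (y_coord k) * D (z_coord k) +
      (D (hamiltonian_fun k) * E t_fun - E (hamiltonian_fun k) * D t_fun)" for k
    using x True by (cases k) (auto simp: chart_form_def restrict_form_def wedge_def differential_def)
  show ?thesis
  proof (cases i)
    case W1
    \<comment> \<open>The part of dz1 proportional to dy3 drops out, dy1 being a multiple of dy3.
      The factors -y1^2 and -y3^2 combine to a square that equals 1.\<close>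
    have "D (y_coord W1) * E (z_coord W1) - E (y_coord W1) * D (z_coord W1) =
        (y_coord W1 x * y_coord W3 x)^2 *
        (D (y_coord W3) * E (z_coord W3) - E (y_coord W3) * D (z_coord W3))"
      unfolding d(1,2) e(1,2) by (simp add: algebra_simps power2_eq_square)
    then show ?thesis by (simp add: W1 form d(5) e(5) inv)
  next
    case W12
    show ?thesis
      unfolding W12 form d(3,4,6) e(3,4,6) d(1) e(1) by (simp add: algebra_simps)
  qed simp
qed (auto simp: chart_form_def restrict_form_def)

section \<open>Agreement, closedness and gluing of the chart forms\<close>

lemma chart_form_eq:
  assumes "x \<in> chart_dom i" "x \<in> chart_dom j"
  shows "chart_form i x D E = chart_form j x D E"
proof (cases "i = j")
  case False
  then have "x \<in> chart_dom W1 \<inter> chart_dom W3 \<inter> chart_dom W12"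
    using chart_dom_Int assms by blast
  then show ?thesis by (simp add: chart_form_overlap[of x i] chart_form_overlap[of x j])
qed simp

lemma represents2_chart_form:
  assumes "\<And>x D E. x \<in> chart_dom i \<Longrightarrow> \<omega> x D E = chart_form i x D E"
  shows "represents2 (chart_dom i) 2 (\<lambda>_ _. 1)
    (\<lambda>k. if k = 0 then y_coord i else hamiltonian_fun i)
    (\<lambda>k. if k = 0 then z_coord i else t_fun) \<omega>"
  unfolding represents2_def
  by (auto simp: assms chart_form_def restrict_form_def numeral_2_eq_2 zariski_open_chart_dom
      regular_on_const regular_on_t_fun regular_on_y_coord regular_on_z_coord
      regular_on_hamiltonian_fun)

lemma two_form_on_chart: "two_form_on (chart_dom i) (chart_form i)"
proof -
  have "restrict_form (chart_dom i) (chart_form i) = chart_form i"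
    by (auto simp: chart_form_def restrict_form_def fun_eq_iff)
  then show ?thesis
    unfolding two_form_on_def
    using zariski_open_chart_dom represents2_chart_form[of i "chart_form i"] by blast
qed

text \<open>The representing coefficients are constant, so every triple wedge has a vanishing first
  factor.\<close>

lemma closed_form_on_chart: "closed_form_on (chart_dom i) (chart_form i)"
  unfolding closed_form_on_def has_exterior_derivative_def
proof
  fix x assume "x \<in> chart_dom i"
  then show "\<exists>N n f g h. x \<in> N \<and> N \<subseteq> chart_dom i \<and> zariski_open N \<and>
      represents2 N n f g h (chart_form i) \<and>
      (\<forall>u\<in>N. \<forall>D\<in>rel_tangent_space u. \<forall>E\<in>rel_tangent_space u. \<forall>F\<in>rel_tangent_space u.
         0 = (\<Sum>k<n. wedge3 (differential (f k)) (differential (g k)) (differential (h k)) u D E F))"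
    using represents2_chart_form[of i "chart_form i", OF refl]
    \<comment> \<open>The families \<open>g\<close> and \<open>h\<close> stay schematic until the
      representation is unified with the goal.\<close>
    by - (rule exI[of _ "chart_dom i"], rule exI[of _ 2], rule exI[of _ "\<lambda>_ _. 1"], rule exI, rule exI,
        intro conjI, assumption, rule order_refl, rule zariski_open_chart_dom, assumption,
        simp add: wedge3_def differential_def tangent_const)
qed

theorem mainTheorem3:
  shows "(\<forall>i. two_form_on (chart_dom i) (chart_form i) \<and> closed_form_on (chart_dom i) (chart_form i)) \<and>
    (\<forall>i j. restrict_form (chart_dom i \<inter> chart_dom j) (chart_form i) =
           restrict_form (chart_dom i \<inter> chart_dom j) (chart_form j)) \<and>
    (\<exists>!\<omega>. two_form_on variety \<omega> \<and> (\<forall>i. restrict_form (chart_dom i) \<omega> = chart_form i))"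
proof (intro conjI allI)
  show "two_form_on (chart_dom i) (chart_form i)" for i by (rule two_form_on_chart)
  show "closed_form_on (chart_dom i) (chart_form i)" for i by (rule closed_form_on_chart)
  show "restrict_form (chart_dom i \<inter> chart_dom j) (chart_form i) =
      restrict_form (chart_dom i \<inter> chart_dom j) (chart_form j)" for i j
    by (intro ext) (simp add: restrict_form_def chart_form_eq[of _ i j] cong: if_cong)
  \<comment> \<open>The chart chosen at a point is immaterial by \<open>chart_form_eq\<close>; the
    value 0 off the variety is the extension required by \<open>two_form_on\<close>.\<close>
  define \<omega> :: form2 where "\<omega> = (\<lambda>x D E. if x \<in> variety
    then chart_form (SOME i. x \<in> chart_dom i) x D E else 0)"
  have \<omega>: "\<omega> x D E = chart_form i x D E" if "x \<in> chart_dom i" for i x D E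
  proof -
    have "x \<in> chart_dom (SOME i. x \<in> chart_dom i)" using that by (rule someI)
    moreover have "x \<in> variety" unfolding variety_eq using that by blast
    ultimately show ?thesis using chart_form_eq[OF _ that] by (simp add: \<omega>_def)
  qed
  have restrict: "restrict_form (chart_dom i) \<omega> = chart_form i" for i
    by (intro ext) (simp add: restrict_form_def \<omega>[of _ i] chart_form_def cong: if_cong)
  have "restrict_form variety \<omega> = \<omega>"
    by (intro ext) (simp add: restrict_form_def \<omega>_def chart_form_def)
  moreover have "\<exists>N n f g h. x \<in> N \<and> N \<subseteq> variety \<and> zariski_open N \<and> represents2 N n f g h \<omega>"
    if "x \<in> variety" for x
  proof -
    obtain i where i: "x \<in> chart_dom i" using \<open>x \<in> variety\<close> unfolding variety_eq by blast
    have "chart_dom i \<subseteq> variety" unfolding variety_eq by blast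
    with i show ?thesis
      using zariski_open_chart_dom[of i] represents2_chart_form[of i \<omega>, OF \<omega>] by blast
  qed
  ultimately have two_form: "two_form_on variety \<omega>"
    by (simp add: two_form_on_def zariski_open_variety)
  show "\<exists>!\<omega>. two_form_on variety \<omega> \<and> (\<forall>i. restrict_form (chart_dom i) \<omega> = chart_form i)"
  proof (intro ex1I[of _ \<omega>] conjI allI two_form restrict)
    fix \<omega>' assume \<omega>': "two_form_on variety \<omega>' \<and> (\<forall>i. restrict_form (chart_dom i) \<omega>' = chart_form i)"
    show "\<omega>' = \<omega>"
    proof (intro ext)
      fix x D E
      \<comment> \<open>Both forms equal their restrictions to the variety, and every point of the
        variety lies in a chart, where the two agree. This gives equality on all arguments.\<close>
      have supp: "restrict_form variety \<omega>' x D E = \<omega>' x D E"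
        "restrict_form variety \<omega> x D E = \<omega> x D E"
        using \<omega>' two_form by (simp_all add: two_form_on_def)
      have "restrict_form (chart_dom i) \<omega>' x D E = restrict_form (chart_dom i) \<omega> x D E" for i
        using \<omega>' restrict by simp
      then have "restrict_form variety \<omega>' x D E = restrict_form variety \<omega> x D E"
        unfolding restrict_form_def variety_eq by (metis UN_iff)
      then show "\<omega>' x D E = \<omega> x D E" using supp by simp
    qed
  qed
qed

end
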